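(* Let $n>1$ be an odd integer. Then, modulo $[n]_{q^2}^4\Phi_n(q^2)$, $$ \sum_{k=0}^{(n+1)/2}[4k-1]_{q^2}[4k-1]^2\frac{(q^{-2};q^4)_k^4}{(q^4;q^4)_k^4}q^{4k} \equiv (2q+2q^{-1}-1)[n]_{q^2}^4, $$ and $$ \sum_{k=0}^{n-1}[4k-1]_{q^2}[4k-1]^2\frac{(q^{-2};q^4)_k^4}{(q^4;q^4)_k^4}q^{4k} \equiv (2q+2q^{-1}-1)[n]_{q^2}^4. $$
   Context: $q$ is an indeterminate. For an integer $m$, $[m]=[m]_q=(1-q^m)/(1-q)$ is the $q$-integer, and $[m]_{q^2}=(1-q^{2m})/(1-q^2)$. The $q$-shifted factorial is $(a;q)_0=1$ and $(a;q)_k=(1-a)(1-aq)\cdots(1-aq^{k-1})$ for $k\ge1$. $\Phi_n(q)$ denotes the $n$-th cyclotomic polynomial. Congruences between rational functions in $q$ modulo a polynomial $P(q)$ mean that the difference of the two sides is a rational function whose denominator is coprime to $P(q)$ and whose numerator is divisible by $P(q)$ in $\mathbb{Z}[q]$ (Laurent monomials such as $q^{-1}$ are allowed, being units modulo $P$). *)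

theory Defs
  imports Complex_Main "HOL-Computational_Algebra.Computational_Algebra"
begin

type_synonym ratfun = "int poly fract"

definition qv :: ratfun where
  "qv = Fract [:0, 1:] 1"

definition qint :: "ratfun \<Rightarrow> int \<Rightarrow> ratfun" where
  "qint x m = (1 - x powi m) / (1 - x)"

definition qpoch :: "ratfun \<Rightarrow> ratfun \<Rightarrow> nat \<Rightarrow> ratfun" where
  "qpoch a x k = (\<Prod>j<k. (1 - a * x ^ j))"

definition cyclotomic :: "nat \<Rightarrow> int poly" where
  "cyclotomic n = (THE p. map_poly of_int p =
     (\<Prod>k\<in>{k. 1 \<le> k \<and> k \<le> n \<and> coprime k n}.
        [:- cis (2 * pi * real k / real n), 1:]))"

definition ratfun_cong :: "ratfun \<Rightarrow> ratfun \<Rightarrow> int poly \<Rightarrow> bool" where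
  "ratfun_cong X Y P \<longleftrightarrow>
     (\<exists>A B. B \<noteq> 0 \<and> coprime B P \<and> P dvd A \<and> X - Y = Fract A B)"

definition qint_sq_poly :: "nat \<Rightarrow> int poly" where
  "qint_sq_poly n = (\<Sum>j<n. monom 1 (2 * j))"

definition summand :: "nat \<Rightarrow> ratfun" where
  "summand k = qint (qv ^ 2) (4 * int k - 1) * (qint qv (4 * int k - 1)) ^ 2
      * qpoch (qv powi (-2)) (qv ^ 4) k ^ 4 / qpoch (qv ^ 4) (qv ^ 4) k ^ 4
      * qv ^ (4 * k)"

end

theory Submission
  imports Defs
begin

text \<open>
  Both truncated sums are evaluated in closed form. Put \<open>y = q\<^sup>2\<close> and \<open>X = q\<^bsup>4m\<^esup>\<close>. The summand is
  Gosper-summable: the sum over \<open>k \<le> m\<close> equals \<open>R\<^sub>m\<^sup>4 N(X) / (q\<^sup>4 (1 - q\<^sup>2)\<^sup>2)\<close>, where \<open>R\<^sub>m\<close> is the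
  product of \<open>(1 - y\<^bsup>2j-1\<^esup>) / (1 - y\<^bsup>2j\<^esup>)\<close> over \<open>1 \<le> j \<le> m\<close> and \<open>N\<close> is quadratic in \<open>X\<close>.
  For both upper limits \<open>R\<^sub>m\<close> is \<open>[n]\<close> (in base \<open>y\<close>) times a Gaussian binomial coefficient, divided by
  \<open>q\<close>-integers and factors \<open>1 + y\<^sup>j\<close> that are coprime to \<open>[n]\<close>. This gives the factor \<open>[n]\<^sup>4\<close>. The cofactor
  is determined modulo \<open>\<Phi>\<^sub>n(q\<^sup>2)\<close> by evaluating it at the points \<open>z\<close> for which \<open>z\<^sup>2\<close> is a primitive
  \<open>n\<close>-th root of unity.
\<close>

section \<open>Telescoping\<close>

text \<open>With X = q^(4m), multiplying by the fourth power of \<open>rprod\<close> turns this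
  into: partial sum up to m plus summand m+1 gives the partial sum up to m+1. Clearing denominators
  leaves the polynomial identity \<open>key\<close>.\<close>

lemma telescoping_step:
  fixes q X :: "'a::field_char_0"
  assumes "q \<noteq> 0" "1 - q \<noteq> 0" "1 + q \<noteq> 0" "1 - q ^ 4 * X \<noteq> 0"
  defines "e \<equiv> \<lambda>X. (2 * q ^ 3 * X\<^sup>2 + (2 * q\<^sup>2 - q ^ 4 - 2 * q ^ 3 - 2 * q - 1) * X + 2 * q)
                     / (q ^ 4 * (1 - q\<^sup>2)\<^sup>2)"
  shows "e X + (1 - q ^ 6 * X\<^sup>2) / (1 - q\<^sup>2) * ((1 - q ^ 3 * X) / (1 - q))\<^sup>2
           * ((1 - 1 / q\<^sup>2) / (1 - q ^ 4 * X)) ^ 4 * (q ^ 4 * X)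
         = ((1 - q\<^sup>2 * X) / (1 - q ^ 4 * X)) ^ 4 * e (q ^ 4 * X)"
proof -
  define u where "u = 1 - q ^ 4 * X"
  define v where "v = 1 - q\<^sup>2"
  define w where "w = 1 - q\<^sup>2 * X"
  define f where "f = 1 - q ^ 6 * X\<^sup>2"
  define g where "g = 1 - q ^ 3 * X"
  define N where "N = (\<lambda>X. 2 * q ^ 3 * X\<^sup>2 + (2 * q\<^sup>2 - q ^ 4 - 2 * q ^ 3 - 2 * q - 1) * X + 2 * q)"
  have v: "v = (1 - q) * (1 + q)" by (simp add: v_def power2_eq_square algebra_simps)
  have nz: "v \<noteq> 0" "u \<noteq> 0" using assms v by (auto simp: u_def)
  \<comment> \<open>Extending by 1 + q leaves only \<open>u\<close>, \<open>v\<close> and powers of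
    q as denominators.\<close>
  have 1: "g / (1 - q) = g * (1 + q) / v"
    using assms(2,3) unfolding v by simp
  have 2: "1 - 1 / q\<^sup>2 = - (v / q\<^sup>2)"
    using assms(1) by (simp add: v_def field_simps)
  have key: "N X * u ^ 4 + f * (g * (1 + q))\<^sup>2 * v ^ 3 * X = w ^ 4 * N (q ^ 4 * X)"
    unfolding u_def v_def w_def f_def g_def N_def by algebra
  have "N X / (q ^ 4 * v\<^sup>2) + f / v * (g * (1 + q) / v)\<^sup>2 * (- (v / q\<^sup>2) / u) ^ 4 * (q ^ 4 * X)
     = (N X * u ^ 4 + f * (g * (1 + q))\<^sup>2 * v ^ 3 * X) / (q ^ 4 * v\<^sup>2 * u ^ 4)"
    using nz assms(1) by (simp add: divide_simps) algebra
  also have "\<dots> = (w / u) ^ 4 * (N (q ^ 4 * X) / (q ^ 4 * v\<^sup>2))"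
    unfolding key by (simp add: power_divide mult.commute)
  finally show ?thesis
    unfolding e_def 2 u_def[symmetric] v_def[symmetric] w_def[symmetric] f_def[symmetric]
      g_def[symmetric] 1 by (simp add: N_def)
qed

text \<open>This is (y;y^2)_m / (y^2;y^2)_m, a q-analogue of the central binomial coefficient of 2m
  divided by 4^m.\<close>

definition rprod :: "'a::field \<Rightarrow> nat \<Rightarrow> 'a" where
  "rprod y m = (\<Prod>j<m. (1 - y ^ (2 * j + 1)) / (1 - y ^ (2 * j + 2)))"

section \<open>The indeterminate in the fraction field and the closed form of the partial
  sums\<close>

lemma qv_to_fract: "qv = to_fract [:0, 1:]"
  by (simp add: qv_def to_fract_def)

lemma to_fract_power [simp]: "to_fract (x ^ n) = to_fract x ^ n"
  by (induction n) auto

lemma qv_power_neq: "i > 0 \<Longrightarrow> qv ^ i \<noteq> 1"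
proof
  assume "i > 0" "qv ^ i = 1"
  then have "to_fract ([:0, 1:] ^ i) = to_fract (1 :: int poly)"
    by (simp add: qv_to_fract)
  then have "([:0, 1:] ^ i :: int poly) = 1" by (simp only: to_fract_eq_iff)
  then have "degree ([:0, 1:] ^ i :: int poly) = 0" by simp
  then show False using \<open>i > 0\<close> by (simp add: degree_power_eq)
qed

lemma qv_neq: "qv \<noteq> 0" "1 - qv \<noteq> 0" "1 + qv \<noteq> 0"
proof -
  show "qv \<noteq> 0" by (simp add: qv_to_fract)
  show "1 - qv \<noteq> 0" using qv_power_neq[of 1] by auto
  have "(1 + qv) * (1 - qv) \<noteq> 0" using qv_power_neq[of 2] by (simp add: algebra_simps power2_eq_square)
  then show "1 + qv \<noteq> 0" by auto
qed

text \<open>The first factor of (q^(-2);q^4)_(m+1) is 1 - q^(-2), and the others form (q^2;q^4)_m;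
  in the denominator the last factor 1 - q^(4m+4) is split off instead.\<close>

lemma qpoch_ratio:
  "qpoch (qv powi (-2)) (qv ^ 4) (Suc m) / qpoch (qv ^ 4) (qv ^ 4) (Suc m)
    = rprod (qv\<^sup>2) m * ((1 - 1 / qv\<^sup>2) / (1 - qv ^ 4 * qv ^ (4 * m)))"
proof (induction m)
  case 0
  show ?case by (simp add: qpoch_def rprod_def power_int_minus field_simps)
next
  case (Suc m)
  have 1: "qv powi (-2) * (qv ^ 4) ^ Suc m = (qv\<^sup>2) ^ (2 * m + 1)"
  proof -
    have "(qv ^ 4) ^ Suc m = qv\<^sup>2 * (qv\<^sup>2) ^ (2 * m + 1)"
      unfolding power_mult[symmetric] power_add[symmetric] by (rule arg_cong[where f = "(^) qv"]) simp
    then show ?thesis using qv_neq(1) by (simp add: power_int_minus del: power_Suc)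
  qed
  have 2: "(qv ^ 4) * (qv ^ 4) ^ Suc m = qv ^ 4 * qv ^ (4 * Suc m)"
    by (simp only: power_mult)
  have 3: "(qv\<^sup>2) ^ (2 * m + 2) = qv ^ 4 * qv ^ (4 * m)"
    unfolding power_mult[symmetric] power_add[symmetric] by (rule arg_cong[where f = "(^) qv"]) simp
  have "qpoch (qv powi (-2)) (qv ^ 4) (Suc (Suc m)) / qpoch (qv ^ 4) (qv ^ 4) (Suc (Suc m))
    = (qpoch (qv powi (-2)) (qv ^ 4) (Suc m) / qpoch (qv ^ 4) (qv ^ 4) (Suc m))
       * ((1 - (qv\<^sup>2) ^ (2 * m + 1)) / (1 - qv ^ 4 * qv ^ (4 * Suc m)))"
    unfolding qpoch_def prod.lessThan_Suc[of _ "Suc m"] 1 2 by simp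
  also have "\<dots> = rprod (qv\<^sup>2) m * ((1 - (qv\<^sup>2) ^ (2 * m + 1)) / (1 - (qv\<^sup>2) ^ (2 * m + 2)))
       * ((1 - 1 / qv\<^sup>2) / (1 - qv ^ 4 * qv ^ (4 * Suc m)))"
    unfolding Suc 3 by (simp only: times_divide_eq_left times_divide_eq_right divide_divide_eq_left mult_ac)
  finally show ?case by (simp only: rprod_def prod.lessThan_Suc)
qed

lemma qint_qv: 
  "qint (qv\<^sup>2) (4 * int (Suc m) - 1) = (1 - qv ^ 6 * (qv ^ (4 * m))\<^sup>2) / (1 - qv\<^sup>2)"
  "qint qv (4 * int (Suc m) - 1) = (1 - qv ^ 3 * qv ^ (4 * m)) / (1 - qv)"
proof -
  have "4 * int (Suc m) - 1 = int (4 * m + 3)" by simp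
  then have *: "x powi (4 * int (Suc m) - 1) = x ^ (4 * m + 3)" for x :: ratfun
    by (simp only: power_int_of_nat)
  show "qint qv (4 * int (Suc m) - 1) = (1 - qv ^ 3 * qv ^ (4 * m)) / (1 - qv)"
    unfolding qint_def * power_add by (simp only: mult.commute)
  have "(qv\<^sup>2) ^ (4 * m + 3) = qv ^ 6 * (qv ^ (4 * m))\<^sup>2"
    unfolding power_mult[symmetric] power_add[symmetric] by (rule arg_cong[where f = "(^) qv"]) simp
  then show "qint (qv\<^sup>2) (4 * int (Suc m) - 1) = (1 - qv ^ 6 * (qv ^ (4 * m))\<^sup>2) / (1 - qv\<^sup>2)"
    by (simp only: qint_def *)
qed

lemma qint_minus_1:
  assumes "x \<noteq> 0" "1 - x \<noteq> 0"
  shows "qint x (-1) = - 1 / x"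
proof -
  have "1 - x powi (-1) = (1 - x) * (- 1 / x)"
    using assms by (simp add: power_int_minus field_simps)
  then show ?thesis using assms by (simp add: qint_def)
qed

lemma sum_summand:
  "(\<Sum>k=0..m. summand k) = rprod (qv\<^sup>2) m ^ 4 *
     ((2 * qv ^ 3 * (qv ^ (4 * m))\<^sup>2 + (2 * qv\<^sup>2 - qv ^ 4 - 2 * qv ^ 3 - 2 * qv - 1) * qv ^ (4 * m) + 2 * qv)
       / (qv ^ 4 * (1 - qv\<^sup>2)\<^sup>2))"
proof (induction m)
  case 0
  have "qint (qv\<^sup>2) (-1) * (qint qv (-1))\<^sup>2 =  - 1 / qv ^ 4"
  proof -
    have "1 - qv\<^sup>2 \<noteq> 0" using qv_power_neq[of 2] by auto
    have "qint (qv\<^sup>2) (-1) = - 1 / qv\<^sup>2" "qint qv (-1) = - 1 / qv"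
      using qint_minus_1[of qv] qint_minus_1[of "qv\<^sup>2"] qv_neq \<open>1 - qv\<^sup>2 \<noteq> 0\<close> by simp_all
    then show ?thesis by (simp add: power2_eq_square power4_eq_xxxx)
  qed
  \<comment> \<open>The quadratic N takes the value -(1 - q^2)^2 at X = 1, so the closed form starts
    with -1/q^4, the summand at k = 0.\<close>
  moreover have "2 * qv ^ 3 + (2 * qv\<^sup>2 - qv ^ 4 - 2 * qv ^ 3 - 2 * qv - 1) + 2 * qv = - (1 - qv\<^sup>2)\<^sup>2"
    by algebra
  moreover have "1 - qv\<^sup>2 \<noteq> 0" using qv_power_neq[of 2] by auto
  ultimately show ?case by (simp add: summand_def qpoch_def rprod_def)
next
  case (Suc m)
  let ?X = "qv ^ (4 * m)"
  have nz: "1 - qv ^ 4 * ?X \<noteq> 0"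
    using qv_power_neq[of "4 + 4 * m"] by (auto simp: power_add)
  have X: "qv ^ (4 * Suc m) = qv ^ 4 * ?X" by (simp add: power_add)
  have s: "summand (Suc m) = rprod (qv\<^sup>2) m ^ 4 * ((1 - qv ^ 6 * ?X\<^sup>2) / (1 - qv\<^sup>2) * ((1 - qv ^ 3 * ?X) / (1 - qv))\<^sup>2
           * ((1 - 1 / qv\<^sup>2) / (1 - qv ^ 4 * ?X)) ^ 4 * (qv ^ 4 * ?X))"
  proof -
    have "summand (Suc m) = qint (qv\<^sup>2) (4 * int (Suc m) - 1) * (qint qv (4 * int (Suc m) - 1))\<^sup>2
       * (qpoch (qv powi (-2)) (qv ^ 4) (Suc m) / qpoch (qv ^ 4) (qv ^ 4) (Suc m)) ^ 4 * qv ^ (4 * Suc m)"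
      by (simp only: summand_def power_divide times_divide_eq_right times_divide_eq_left)
    then show ?thesis
      unfolding qint_qv qpoch_ratio X power_mult_distrib[of "rprod _ _"] by (simp only: mult_ac)
  qed
  have r: "rprod (qv\<^sup>2) (Suc m) = rprod (qv\<^sup>2) m * ((1 - qv\<^sup>2 * ?X) / (1 - qv ^ 4 * ?X))"
  proof -
    have "(qv\<^sup>2) ^ (2 * m + 1) = qv\<^sup>2 * ?X" "(qv\<^sup>2) ^ (2 * m + 2) = qv ^ 4 * ?X"
      unfolding power_mult[symmetric] power_add[symmetric]
      by (rule arg_cong[where f = "(^) qv"], simp)+
    then show ?thesis by (simp only: rprod_def prod.lessThan_Suc)
  qed
  show ?case
    unfolding sum.atLeast0_atMost_Suc Suc s r X power_mult_distrib[of "rprod _ _"]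
      distrib_left[symmetric] telescoping_step[OF qv_neq nz] by (simp only: mult.assoc)
qed

section \<open>Integer polynomials and primitive roots of unity\<close>

abbreviation cpoly :: "int poly \<Rightarrow> complex poly" where
  "cpoly \<equiv> map_poly of_int"

lemma cpoly_add [simp]: "cpoly (p + r) = cpoly p + cpoly r"
  by (rule poly_eqI) (simp add: coeff_map_poly)

lemma cpoly_diff [simp]: "cpoly (p - r) = cpoly p - cpoly r"
  by (rule poly_eqI) (simp add: coeff_map_poly)

lemma cpoly_mult [simp]: "cpoly (p * r) = cpoly p * cpoly r"
  by (rule poly_eqI) (simp add: coeff_map_poly coeff_mult)

lemma cpoly_power [simp]: "cpoly (p ^ n) = cpoly p ^ n"
  by (induction n) auto

lemma cpoly_prod: "cpoly (prod f A) = (\<Prod>x\<in>A. cpoly (f x))"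
  by (induction A rule: infinite_finite_induct) auto

lemma cpoly_pcompose: "cpoly (pcompose p r) = pcompose (cpoly p) (cpoly r)"
  by (induction p) (auto simp: pcompose_pCons map_poly_pCons)

lemma degree_cpoly [simp]: "degree (cpoly p) = degree p"
  by (rule degree_map_poly) auto

lemma cpoly_inject: "cpoly p = cpoly r \<longleftrightarrow> p = r"
  by (auto simp: poly_eq_iff coeff_map_poly)

lemma lead_coeff_cpoly: "lead_coeff (cpoly p) = of_int (lead_coeff p)"
  by (simp add: coeff_map_poly)

text \<open>Transfers divisibility from complex to integer polynomials. Division with remainder by a
  monic integer polynomial stays integral, and the remainder would be a complex multiple of
  \<open>d\<close> of smaller degree, hence is zero.\<close>

lemma cpoly_dvd_monic:
  assumes "lead_coeff d = 1" "cpoly p = cpoly d * c"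
  obtains s where "p = d * s" "c = cpoly s"
proof -
  obtain s r where sr: "pseudo_divmod p d = (s, r)" by fastforce
  have "d \<noteq> 0" using assms(1) by auto
  from pseudo_divmod[OF this sr] assms(1)
  have p: "p = d * s + r" and deg: "r = 0 \<or> degree r < degree d" by auto
  have r: "cpoly r = cpoly d * (c - cpoly s)"
    using assms(2) unfolding p by (simp add: algebra_simps)
  have "c = cpoly s"
  proof (rule ccontr)
    assume "c \<noteq> cpoly s"
    moreover have "cpoly d \<noteq> 0" using \<open>d \<noteq> 0\<close> cpoly_inject[of d 0] by simp
    ultimately have "degree r = degree d + degree (c - cpoly s)" "cpoly r \<noteq> 0"
      using r degree_mult_eq[of "cpoly d" "c - cpoly s"] degree_cpoly[of r] by auto
    then show False using deg by auto
  qed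
  then have "cpoly r = 0" using r by simp
  then have "r = 0" using cpoly_inject[of r 0] by simp
  then show ?thesis using that[of s] p \<open>c = cpoly s\<close> by simp
qed

text \<open>A common divisor of positive degree would produce a common complex root; a constant one
  divides the leading coefficient 1 of \<open>p\<close>, so it is a unit.\<close>

lemma coprime_monic_if_no_common_root:
  assumes "lead_coeff p = 1"
    and "\<And>z. poly (cpoly p) z = 0 \<Longrightarrow> poly (cpoly r) z \<noteq> 0"
  shows "coprime r p"
proof (rule coprimeI)
  fix g assume g: "g dvd r" "g dvd p"
  then obtain h where h: "p = g * h" by auto
  have lead: "lead_coeff g * lead_coeff h = 1" using assms(1) h by (simp add: lead_coeff_mult)
  have "degree g = 0"
  proof (rule ccontr)
    assume "degree g \<noteq> 0"
    then have "\<not> constant (poly (cpoly g))"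
      by (simp add: constant_degree)
    from fundamental_theorem_of_algebra[OF this] obtain z where "poly (cpoly g) z = 0" by auto
    then have "poly (cpoly p) z = 0" "poly (cpoly r) z = 0"
      using g by (metis cpoly_mult dvdE mult_zero_left poly_mult)+
    then show False using assms(2) by blast
  qed
  then obtain a where "g = [:a:]" using degree_eq_zeroE by blast
  then show "is_unit g" using lead dvdI[of 1 a "lead_coeff h"] by (simp add: is_unit_const_poly_iff)
qed

lemma prod_linear_dvd:
  fixes p :: "complex poly"
  assumes "finite A" "\<And>z. z \<in> A \<Longrightarrow> poly p z = 0"
  shows "(\<Prod>z\<in>A. [:- z, 1:]) dvd p"
  using assms
proof (induction A rule: finite_induct)
  case (insert a A)
  then obtain c where c: "p = (\<Prod>z\<in>A. [:- z, 1:]) * c" by auto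
  have "poly (\<Prod>z\<in>A. [:- z, 1:]) a \<noteq> 0" using insert by (auto simp: poly_prod)
  then have "poly c a = 0" using insert.prems[of a] c by auto
  then have "[:- a, 1:] dvd c" by (simp add: poly_eq_0_iff_dvd)
  then have "[:- a, 1:] * (\<Prod>z\<in>A. [:- z, 1:]) dvd c * (\<Prod>z\<in>A. [:- z, 1:])"
    by (rule mult_dvd_mono) simp
  then show ?case unfolding c prod.insert[OF insert.hyps] by (simp only: mult.commute)
qed auto

text \<open>For nonzero a the polynomial x^2 - a has two distinct simple roots s and -s, and the
  factors for different a share no root.\<close>

lemma prod_quadratic_dvd:
  fixes p :: "complex poly"
  assumes "finite A" "0 \<notin> A" "\<And>z. z\<^sup>2 \<in> A \<Longrightarrow> poly p z = 0"
  shows "(\<Prod>w\<in>A. [:- w, 0, 1:]) dvd p"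
  using assms
proof (induction A rule: finite_induct)
  case (insert a A)
  then obtain c where c: "p = (\<Prod>w\<in>A. [:- w, 0, 1:]) * c" by auto
  define s where "s = csqrt a"
  have s: "s\<^sup>2 = a" "s \<noteq> 0" using insert by (auto simp: s_def)
  have c0: "poly c z = 0" if "z\<^sup>2 = a" for z
  proof -
    have "poly (\<Prod>w\<in>A. [:- w, 0, 1:]) z \<noteq> 0"
      using insert that by (auto simp: poly_prod power2_eq_square)
    then show ?thesis using insert.prems(2)[of z] that c by auto
  qed
  have "(\<Prod>z\<in>{s, -s}. [:- z, 1:]) dvd c"
    by (rule prod_linear_dvd) (use c0 s in auto)
  moreover have "s \<noteq> - s" using s by simp
  ultimately have "[:- a, 0, 1:] dvd c" using s by (simp add: power2_eq_square)
  then have "[:- a, 0, 1:] * (\<Prod>w\<in>A. [:- w, 0, 1:]) dvd c * (\<Prod>w\<in>A. [:- w, 0, 1:])"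
    by (rule mult_dvd_mono) simp
  then show ?case unfolding c prod.insert[OF insert.hyps] by (simp only: mult.commute)
qed auto

section \<open>Primitive roots of unity and integrality of the cyclotomic polynomials\<close>

definition primroots :: "nat \<Rightarrow> complex set" where
  "primroots n = {z. z ^ n = 1 \<and> (\<forall>i. 0 < i \<and> i < n \<longrightarrow> z ^ i \<noteq> 1)}"

text \<open>Reducing k modulo n does not change the root, and below n the parametrization of the
  roots of unity is injective.\<close>

lemma cis_root_unity_eq_1_iff:
  assumes "n > 0"
  shows "cis (2 * pi * real k / real n) = 1 \<longleftrightarrow> n dvd k"
proof
  assume *: "cis (2 * pi * real k / real n) = 1"
  have "real k = real n * real (k div n) + real (k mod n)"
    by (metis mult_div_mod_eq of_nat_add of_nat_mult)
  then have "2 * pi * real k / real n = 2 * pi * real (k div n) + 2 * pi * real (k mod n) / real n"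
    using assms by (simp add: field_simps)
  then have "cis (2 * pi * real k / real n) = cis (2 * pi * real (k mod n) / real n)"
    by (simp add: cis_mult[symmetric])
  then have "cis (2 * pi * real (k mod n) / real n) = cis (2 * pi * real 0 / real n)"
    using * by simp
  then have "k mod n = 0"
    using bij_betw_roots_unity[OF assms] assms unfolding bij_betw_def
    by (elim conjE inj_onD) auto
  then show "n dvd k" by auto
next
  assume "n dvd k"
  then obtain j where "k = n * j" by auto
  then show "cis (2 * pi * real k / real n) = 1"
    using assms cis_multiple_2pi[of "real j"] by (simp add: mult.assoc)
qed

text \<open>Connects the coprime indices in the definition of \<open>cyclotomic\<close> with exact
  multiplicative order, the form in which evaluations are made.\<close>

lemma bij_betw_primroots:
  assumes "n > 0"
  shows "bij_betw (\<lambda>k. cis (2 * pi * real k / real n)) {k. 1 \<le> k \<and> k \<le> n \<and> coprime k n} (primroots n)"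
proof -
  let ?f = "\<lambda>k. cis (2 * pi * real k / real n)"
  have pow: "?f k ^ i = ?f (k * i)" for k i
    by (simp add: DeMoivre field_simps)
  have inj: "inj_on ?f {..<n}" and img: "?f ` {..<n} = {z. z ^ n = 1}"
    using bij_betw_roots_unity[OF assms] by (auto simp: bij_betw_def)
  show ?thesis
  proof (cases "n = 1")
    case True
    then have "{k. 1 \<le> k \<and> k \<le> n \<and> coprime k n} = {1}" by auto
    then show ?thesis using True by (auto simp: bij_betw_def primroots_def)
  next
    case False
    let ?K = "{k. 1 \<le> k \<and> k \<le> n \<and> coprime k n}"
    \<comment> \<open>Coprimality excludes the index k = n unless n = 1, which is why that case is
      separate.\<close>
    have K: "?K \<subseteq> {..<n}" using False by (auto simp: nat_less_le)
    have "?f ` ?K = primroots n"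
    proof (intro equalityI subsetI)
      fix z assume "z \<in> ?f ` ?K"
      then obtain k where k: "z = ?f k" "coprime k n" by auto
      have "z ^ i \<noteq> 1" if "0 < i" "i < n" for i
        using that k cis_root_unity_eq_1_iff[OF assms, of "k * i"] pow[of k i]
        by (auto simp: coprime_dvd_mult_right_iff coprime_commute dest: dvd_imp_le)
      moreover have "z ^ n = 1"
        using k cis_root_unity_eq_1_iff[OF assms, of "k * n"] pow[of k n] by auto
      ultimately show "z \<in> primroots n" by (auto simp: primroots_def)
    next
      fix z assume z: "z \<in> primroots n"
      then obtain k where k: "k < n" "z = ?f k" using img by (auto simp: primroots_def)
      \<comment> \<open>A common factor g of k and n gives z^(n/g) = 1, so exact order n forces g =
        1.\<close>
      define g where "g = gcd k n"
      have g: "g > 0" "g dvd n" "g dvd k" using assms by (auto simp: g_def)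
      have "n dvd k * (n div g)"
        using g by (metis dvd_mult_div_cancel dvd_triv_right mult.assoc mult.commute div_mult_swap dvd_div_mult_self)
      then have "z ^ (n div g) = 1"
        using cis_root_unity_eq_1_iff[OF assms, of "k * (n div g)"] pow[of k "n div g"] k by auto
      moreover have "n div g > 0" using g assms by (auto simp: dvd_div_eq_0_iff)
      ultimately have "\<not> n div g < n" using z by (auto simp: primroots_def)
      then have "g = 1" using g assms by (metis div_less_dividend nat_neq_iff less_one)
      then have "coprime k n" by (simp add: g_def coprime_iff_gcd_eq_1)
      moreover have "k \<noteq> 0" using False \<open>coprime k n\<close> by (intro notI) simp
      ultimately show "z \<in> ?f ` ?K" using k by auto
    qed
    then show ?thesis using inj K by (auto simp: bij_betw_def intro: inj_on_subset)
  qed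
qed

lemma finite_primroots: "n > 0 \<Longrightarrow> finite (primroots n)"
  by (rule finite_subset[OF _ finite_roots_unity[of n]]) (auto simp: primroots_def)

text \<open>The order d of a root is its least positive exponent; minimality applied to n mod d
  gives d dvd n.\<close>

lemma roots_unity_eq_UN_primroots:
  assumes "n > 0"
  shows "{z. z ^ n = 1} = (\<Union>d\<in>{d. d dvd n}. primroots d)"
proof (intro equalityI subsetI)
  fix z :: complex assume z: "z \<in> {z. z ^ n = 1}"
  define d where "d = (LEAST d. d > 0 \<and> z ^ d = 1)"
  have d: "d > 0 \<and> z ^ d = 1"
    unfolding d_def by (rule LeastI[of _ n]) (use z assms in auto)
  have min: "z ^ i \<noteq> 1" if "0 < i" "i < d" for i
    using not_less_Least[of i "\<lambda>d. d > 0 \<and> z ^ d = 1"] that by (auto simp: d_def)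
  have "z ^ n = (z ^ d) ^ (n div d) * z ^ (n mod d)"
    by (simp flip: power_mult power_add)
  then have "z ^ (n mod d) = 1" using z d by simp
  then have "n mod d = 0" using min[of "n mod d"] d by auto
  then have "d dvd n" by auto
  then show "z \<in> (\<Union>d\<in>{d. d dvd n}. primroots d)" using d min by (auto simp: primroots_def)
qed (auto simp: primroots_def elim!: dvdE simp: power_mult)

lemma primroots_disjoint:
  assumes "d > 0" "e > 0" "d \<noteq> e"
  shows "primroots d \<inter> primroots e = {}"
  using assms by (auto simp: primroots_def) (metis nat_neq_iff)

text \<open>Distinct roots make the product a divisor of x^n - 1, and both polynomials are monic of
  degree n.\<close>

lemma prod_roots_unity:
  assumes "n > 0"
  shows "(\<Prod>z\<in>{z::complex. z ^ n = 1}. [:- z, 1:]) = monom 1 n - 1"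
proof -
  let ?p = "\<Prod>z\<in>{z::complex. z ^ n = 1}. [:- z, 1:]"
  have fin: "finite {z::complex. z ^ n = 1}" using assms by (intro finite_roots_unity) auto
  have "?p dvd monom 1 n - 1"
    by (rule prod_linear_dvd[OF fin]) (auto simp: poly_monom)
  then obtain c where c: "monom 1 n - 1 = ?p * c" by auto
  have dm: "degree (monom 1 n - 1 :: complex poly) = n"
    using assms by (subst diff_conv_add_uminus, subst degree_add_eq_left) (auto simp: degree_monom_eq)
  have lm: "lead_coeff (monom 1 n - 1 :: complex poly) = 1"
    unfolding dm using assms by simp
  have lp: "lead_coeff ?p = 1" by (simp add: lead_coeff_prod)
  have dp: "degree ?p = n"
    using card_roots_unity_eq[OF assms] by (subst degree_prod_eq_sum_degree) auto
  have "c \<noteq> 0" "?p \<noteq> 0" using c dm assms by auto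
  then have "degree c = 0" using c dm dp degree_mult_eq[of ?p c] by simp
  then obtain a where "c = [:a:]" using degree_eq_zeroE by blast
  moreover have "lead_coeff c = 1" using c lm lp by (metis lead_coeff_mult mult_1)
  ultimately show ?thesis using c by (simp add: one_pCons[symmetric])
qed

text \<open>Strong induction: x^n - 1 is the product of these polynomials over all divisors of n.
  The part from proper divisors is monic and integral, so the exact quotient is integral by
  \<open>cpoly_dvd_monic\<close>.\<close>

lemma prod_primroots_integral:
  assumes "n > 0"
  shows "\<exists>p. cpoly p = (\<Prod>z\<in>primroots n. [:- z, 1:])"
  using assms
proof (induction n rule: less_induct)
  case (less n)
  let ?D = "{d. d dvd n \<and> d \<noteq> n}"
  have fin: "finite ?D" using less.prems by simp
  have "\<exists>p. \<forall>d\<in>?D. cpoly (p d) = (\<Prod>z\<in>primroots d. [:- z, 1:])"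
  proof (rule bchoice, rule ballI)
    fix d assume "d \<in> ?D"
    then have "d < n" "d > 0" using less.prems dvd_imp_le[of d n] dvd_pos_nat[of n d] by auto
    then show "\<exists>p. cpoly p = (\<Prod>z\<in>primroots d. [:- z, 1:])" by (rule less.IH)
  qed
  then obtain p where p: "\<And>d. d \<in> ?D \<Longrightarrow> cpoly (p d) = (\<Prod>z\<in>primroots d. [:- z, 1:])" by blast
  define Q where "Q = (\<Prod>d\<in>?D. p d)"
  have Q: "cpoly Q = (\<Prod>d\<in>?D. \<Prod>z\<in>primroots d. [:- z, 1:])"
    unfolding Q_def cpoly_prod by (intro prod.cong refl p)
  have "of_int (lead_coeff Q) = (1::complex)"
    unfolding lead_coeff_cpoly[symmetric] Q by (simp add: lead_coeff_prod)
  then have monic: "lead_coeff Q = 1" by simp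
  have "cpoly (monom 1 n - 1) = monom 1 n - 1"
    by (simp add: map_poly_monom)
  also have "\<dots> = (\<Prod>z\<in>(\<Union>d\<in>{d. d dvd n}. primroots d). [:- z, 1:])"
    using prod_roots_unity[OF less.prems] roots_unity_eq_UN_primroots[OF less.prems] by simp
  also have "\<dots> = (\<Prod>d\<in>{d. d dvd n}. \<Prod>z\<in>primroots d. [:- z, 1:])"
  proof (rule prod.UNION_disjoint)
    show "finite {d. d dvd n}" using less.prems by simp
    show "\<forall>i\<in>{d. d dvd n}. finite (primroots i)"
      using less.prems by (auto intro!: finite_primroots dvd_pos_nat[of n])
    show "\<forall>i\<in>{d. d dvd n}. \<forall>j\<in>{d. d dvd n}. i \<noteq> j \<longrightarrow> primroots i \<inter> primroots j = {}"
      using less.prems by (intro ballI impI primroots_disjoint) (auto intro: dvd_pos_nat[of n])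
  qed
  also have "{d. d dvd n} = insert n ?D" by auto
  also have "(\<Prod>d\<in>insert n ?D. \<Prod>z\<in>primroots d. [:- z, 1:]) = cpoly Q * (\<Prod>z\<in>primroots n. [:- z, 1:])"
    using fin unfolding Q by (subst prod.insert) (auto simp: mult.commute)
  finally show ?case using cpoly_dvd_monic[OF monic] by metis
qed

text \<open>The definite description in \<open>cyclotomic\<close> is meaningful: existence is the
  integrality above, uniqueness is the injectivity of \<open>cpoly\<close>.\<close>

lemma cpoly_cyclotomic:
  assumes "n > 0"
  shows "cpoly (cyclotomic n) = (\<Prod>z\<in>primroots n. [:- z, 1:])"
proof -
  let ?P = "\<Prod>k\<in>{k. 1 \<le> k \<and> k \<le> n \<and> coprime k n}. [:- cis (2 * pi * real k / real n), 1:]"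
  have eq: "?P = (\<Prod>z\<in>primroots n. [:- z, 1:])"
    by (rule prod.reindex_bij_betw[OF bij_betw_primroots[OF assms]])
  obtain p where p: "cpoly p = ?P"
    using prod_primroots_integral[OF assms] eq by auto
  have "cpoly (cyclotomic n) = ?P"
    unfolding cyclotomic_def by (rule theI[of "\<lambda>p. cpoly p = ?P"]) (use p in \<open>auto simp: cpoly_inject[symmetric]\<close>)
  then show ?thesis using eq by simp
qed

section \<open>Gaussian binomial coefficients\<close>

text \<open>This is the shifted factorial (y^(m+1);y)_k; for m = 0 it is (y;y)_k.\<close>

definition qprod :: "'a::comm_ring_1 \<Rightarrow> nat \<Rightarrow> nat \<Rightarrow> 'a" where
  "qprod y m k = (\<Prod>j<k. (1 - y ^ (m + 1 + j)))"

text \<open>\<open>qbinom y m k\<close> is the Gaussian binomial coefficient of \<open>m + k\<close> over \<open>k\<close>, not of \<open>m\<close> over \<open>k\<close>.\<close>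

fun qbinom :: "'a::comm_ring_1 \<Rightarrow> nat \<Rightarrow> nat \<Rightarrow> 'a" where
  "qbinom y m 0 = 1"
| "qbinom y 0 (Suc k) = 1"
| "qbinom y (Suc m) (Suc k) = qbinom y (Suc m) k + y ^ Suc k * qbinom y m (Suc k)"

lemma qprod_Suc: "qprod y m (Suc k) = qprod y m k * (1 - y ^ (m + 1 + k))"
  by (simp add: qprod_def)

lemma qprod_Suc_shift: "qprod y m (Suc k) = (1 - y ^ Suc m) * qprod y (Suc m) k"
  unfolding qprod_def prod.lessThan_Suc_shift by simp

lemma qprod_add: "qprod y 0 (m + k) = qprod y 0 m * qprod y m k"
  by (induction k) (simp_all add: qprod_def mult.assoc)

text \<open>The usual quotient formula, cleared of denominators so that it holds in every
  commutative ring. The recursion fits because (1 - y^(k+1)) + y^(k+1) (1 - y^(m+1)) = 1 -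
  y^(m+k+2).\<close>

lemma qbinom_mult_qprod: "qbinom y m k * qprod y 0 k = qprod y m k"
proof (induction y m k rule: qbinom.induct)
  case (3 y m k)
  have "qbinom y (Suc m) (Suc k) * qprod y 0 (Suc k)
      = (qbinom y (Suc m) k * qprod y 0 k) * (1 - y ^ Suc k)
        + y ^ Suc k * (qbinom y m (Suc k) * qprod y 0 (Suc k))"
    by (simp add: qprod_Suc[of y 0] algebra_simps)
  also have "\<dots> = qprod y (Suc m) k * (1 - y ^ Suc k) + y ^ Suc k * ((1 - y ^ Suc m) * qprod y (Suc m) k)"
    unfolding 3 qprod_Suc_shift[of y m] ..
  also have "\<dots> = qprod y (Suc m) k * (1 - y ^ Suc k * y ^ Suc m)"
    by (simp add: algebra_simps del: power_Suc)
  also have "y ^ Suc k * y ^ Suc m = y ^ (Suc m + 1 + k)"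
    by (simp add: power_add[symmetric] add_ac del: power_Suc)
  finally show ?case by (simp only: qprod_Suc)
qed (auto simp: qprod_def)

section \<open>The products \<open>rprod\<close> in terms of Gaussian binomial coefficients\<close>

definition plusprod :: "'a::comm_ring_1 \<Rightarrow> nat \<Rightarrow> 'a" where
  "plusprod y m = (\<Prod>j<m. (1 + y ^ Suc j))"

lemma plusprod_Suc: "plusprod y (Suc m) = plusprod y m * (1 + y ^ Suc m)"
  by (simp add: plusprod_def)

lemma qprod_0_neq_0:
  fixes y :: "'a::field"
  assumes "\<And>i. 0 < i \<Longrightarrow> i \<le> m \<Longrightarrow> y ^ i \<noteq> 1"
  shows "qprod y 0 m \<noteq> 0"
  using assms by (auto simp: qprod_def simp del: power_Suc)

text \<open>From 1 - y^(2j) = (1 - y^j)(1 + y^j), the product of all 1 - y^(2j) with 1 <= j <= m is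
  (y;y)_m times \<open>plusprod y m\<close>. So \<open>rprod y m\<close> is (y;y)_(2m) over the
  square of that product.\<close>

lemma rprod_mult_plusprod:
  fixes y :: "'a::field"
  assumes "\<And>i. i > 0 \<Longrightarrow> y ^ i \<noteq> 1"
  shows "rprod y m * plusprod y m ^ 2 = qbinom y m m"
proof -
  have "rprod y m * plusprod y m ^ 2 * qprod y 0 m ^ 2 = qprod y 0 (2 * m)"
  proof (induction m)
    case 0
    show ?case by (simp add: rprod_def plusprod_def qprod_def)
  next
    case (Suc m)
    let ?a = "y ^ Suc m"
    have a2: "y ^ (2 * m + 2) = ?a\<^sup>2" by (simp add: power2_eq_square mult_2 power_add)
    have nz: "1 - ?a\<^sup>2 \<noteq> 0" using assms[of "2 * m + 2"] a2 by auto
    have "rprod y (Suc m) * plusprod y (Suc m) ^ 2 * qprod y 0 (Suc m) ^ 2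
      = (rprod y m * plusprod y m ^ 2 * qprod y 0 m ^ 2) *
        ((1 - y ^ (2 * m + 1)) / (1 - ?a\<^sup>2) * ((1 + ?a) * (1 - ?a))\<^sup>2)"
      unfolding plusprod_Suc qprod_Suc by (simp add: rprod_def a2[simplified] power_mult_distrib)
    also have "(1 + ?a) * (1 - ?a) = 1 - ?a\<^sup>2" by (simp add: power2_eq_square algebra_simps)
    also have "(1 - y ^ (2 * m + 1)) / (1 - ?a\<^sup>2) * (1 - ?a\<^sup>2)\<^sup>2 = (1 - y ^ (2 * m + 1)) * (1 - y ^ (2 * m + 2))"
      unfolding a2 using nz by (simp only: power2_eq_square[of "1 - ?a\<^sup>2"]) simp
    finally show ?case unfolding Suc by (simp add: qprod_def mult.assoc)
  qed
  also have "\<dots> = qprod y 0 m * (qbinom y m m * qprod y 0 m)"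
    by (simp only: mult_2 qprod_add qbinom_mult_qprod)
  finally show ?thesis
    using qprod_0_neq_0[OF assms, of m] by (simp add: power2_eq_square)
qed

text \<open>For n = 2m+1 the upper limit (n+1)/2 is m+1. The last factor (1 - y^n) / (1 - y^(n+1))
  supplies [n] as numerator and [n+1] as denominator.\<close>

lemma rprod_half:
  fixes y :: "'a::field"
  assumes "\<And>i. i > 0 \<Longrightarrow> y ^ i \<noteq> 1"
  shows "rprod y (Suc m) * ((\<Sum>i<2 * m + 2. y ^ i) * plusprod y m ^ 2)
       = (\<Sum>i<2 * m + 1. y ^ i) * qbinom y m m"
proof -
  have eq: "rprod y m * plusprod y m ^ 2 = qbinom y m m"
    by (rule rprod_mult_plusprod) (rule assms)
  have 1: "1 - y \<noteq> 0" using assms[of 1] by auto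
  have 2: "1 - y ^ (2 * m + 2) \<noteq> 0" using assms[of "2 * m + 2"] by auto
  have "rprod y (Suc m) * ((1 - y ^ (2 * m + 2)) * plusprod y m ^ 2) 
     = (1 - y ^ (2 * m + 1)) * (rprod y m * plusprod y m ^ 2)"
    using 2 unfolding rprod_def prod.lessThan_Suc by simp
  then have "(1 - y) * (rprod y (Suc m) * ((\<Sum>i<2 * m + 2. y ^ i) * plusprod y m ^ 2))
      = (1 - y) * ((\<Sum>i<2 * m + 1. y ^ i) * qbinom y m m)"
    unfolding eq one_diff_power_eq by (simp only: mult_ac)
  then show ?thesis using 1 by (simp only: mult_cancel_left) simp
qed

text \<open>For m = n-1 the factor [n] comes out of the central binomial itself: (1 - y^(m+1)) times
  the Gaussian binomial of 2m+1 over m equals (1 - y^(2m+1)) times that of 2m over m. This makes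
  [2n-1] a denominator.\<close>

lemma rprod_full:
  fixes y :: "'a::field"
  assumes "\<And>i. i > 0 \<Longrightarrow> y ^ i \<noteq> 1"
  shows "rprod y m * ((\<Sum>i<2 * m + 1. y ^ i) * plusprod y m ^ 2)
       = (\<Sum>i<Suc m. y ^ i) * qbinom y (Suc m) m"
proof -
  have eq: "rprod y m * plusprod y m ^ 2 = qbinom y m m"
    by (rule rprod_mult_plusprod) (rule assms)
  have 1: "1 - y \<noteq> 0" using assms[of 1] by auto
  have "(1 - y ^ Suc m) * qbinom y (Suc m) m * qprod y 0 m = (1 - y ^ Suc m) * qprod y (Suc m) m"
    by (simp only: mult.assoc qbinom_mult_qprod)
  also have "\<dots> = qprod y m m * (1 - y ^ (m + 1 + m))"
    by (simp only: qprod_Suc_shift[symmetric] qprod_Suc)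
  also have "\<dots> = (1 - y ^ (2 * m + 1)) * qbinom y m m * qprod y 0 m"
    unfolding qbinom_mult_qprod[of y m m, symmetric] by (simp add: mult_2 del: power_Suc)
  finally have "(1 - y ^ Suc m) * qbinom y (Suc m) m = (1 - y ^ (2 * m + 1)) * qbinom y m m"
    using qprod_0_neq_0[OF assms, of m] by simp
  then have "(1 - y) * ((1 - y) * ((\<Sum>i<Suc m. y ^ i) * qbinom y (Suc m) m)) = 
      (1 - y) * ((1 - y) * ((\<Sum>i<2 * m + 1. y ^ i) * qbinom y m m))"
    unfolding one_diff_power_eq by (simp only: mult.assoc)
  then have "(\<Sum>i<Suc m. y ^ i) * qbinom y (Suc m) m = (\<Sum>i<2 * m + 1. y ^ i) * qbinom y m m"
    using 1 by (simp only: mult_cancel_left) simp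
  then show ?thesis by (simp only: eq[symmetric] mult_ac)
qed

section \<open>Transfer to the fraction field and values at primitive roots of unity\<close>

lemma to_fract_qbinom: "to_fract (qbinom y m k) = qbinom (to_fract y) m k"
  by (induction y m k rule: qbinom.induct) simp_all

lemma to_fract_plusprod: "to_fract (plusprod y m) = plusprod (to_fract y) m"
  by (induction m) (simp_all add: plusprod_def)

lemma poly_cpoly_qbinom: "poly (cpoly (qbinom y m k)) z = qbinom (poly (cpoly y) z) m k"
  by (induction y m k rule: qbinom.induct) simp_all

lemma poly_cpoly_plusprod: "poly (cpoly (plusprod y m)) z = plusprod (poly (cpoly y) z) m"
  by (induction m) (simp_all add: plusprod_def)

lemma poly_cpoly_sum: "poly (cpoly (\<Sum>i<m. y ^ i)) z = (\<Sum>i<m. poly (cpoly y) z ^ i)"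
  by (induction m) simp_all

text \<open>As the order of w is odd, squaring permutes its nontrivial powers. So the products of 1
  - w^(2j) and of 1 - w^j over 1 <= j <= 2m agree, and their quotient is the product of 1 +
  w^j.\<close>

lemma plusprod_eq_1:
  fixes w :: complex
  assumes "w \<in> primroots (2 * m + 1)"
  shows "plusprod w (2 * m) = 1"
proof -
  have w: "w ^ (2 * m + 1) = 1" and ord: "\<And>i. 0 < i \<Longrightarrow> i \<le> 2 * m \<Longrightarrow> w ^ i \<noteq> 1"
    using assms by (auto simp: primroots_def)
  have pair: "(\<Prod>j<k. (1 - w ^ (2 * j + 2)) * (1 - w ^ (2 * j + 1))) = qprod w 0 (2 * k)" for k
    by (induction k) (simp_all add: qprod_def mult_ac)
  have "plusprod w (2 * m) * qprod w 0 (2 * m) = (\<Prod>j<2 * m. 1 - w ^ (2 * j + 2))"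
    unfolding plusprod_def qprod_def prod.distrib[symmetric]
    by (intro prod.cong refl) (simp add: algebra_simps power_add[symmetric] mult_2 mult_2_right)
  also have "\<dots> = (\<Prod>j<m. 1 - w ^ (2 * j + 2)) * (\<Prod>j<m. 1 - w ^ (2 * (m + j) + 2))"
  proof -
    have "(\<Prod>j<m + k. 1 - w ^ (2 * j + 2)) = (\<Prod>j<m. 1 - w ^ (2 * j + 2)) * (\<Prod>j<k. 1 - w ^ (2 * (m + j) + 2))" for k
      by (induction k) (simp_all add: mult.assoc)
    then show ?thesis by (simp only: mult_2[of m])
  qed
  \<comment> \<open>Even exponents above the order 2m+1 reduce to the odd exponents below
    it.\<close>
  also have "(\<Prod>j<m. 1 - w ^ (2 * (m + j) + 2)) = (\<Prod>j<m. 1 - w ^ (2 * j + 1))"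
  proof (intro prod.cong refl)
    fix j
    have "w ^ (2 * (m + j) + 2) = w ^ (2 * m + 1) * w ^ (2 * j + 1)"
      unfolding power_add[symmetric] by (rule arg_cong[where f = "(^) w"]) simp
    then show "1 - w ^ (2 * (m + j) + 2) = 1 - w ^ (2 * j + 1)" unfolding w by simp
  qed
  also have "(\<Prod>j<m. 1 - w ^ (2 * j + 2)) * \<dots> = qprod w 0 (2 * m)"
    unfolding prod.distrib[symmetric] by (rule pair)
  finally show ?thesis using qprod_0_neq_0[OF ord] by simp
qed

text \<open>The numerator has exponents m+2 to 2m+1; reducing them by the order m+1 gives the
  exponents 1 to m of the denominator.\<close>

lemma qbinom_full_eq_1:
  fixes w :: complex
  assumes "w \<in> primroots (Suc m)"
  shows "qbinom w (Suc m) m = 1"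
proof -
  have w: "w ^ Suc m = 1" and ord: "\<And>i. 0 < i \<Longrightarrow> i \<le> m \<Longrightarrow> w ^ i \<noteq> 1"
    using assms by (auto simp: primroots_def)
  have "qprod w (Suc m) m = qprod w 0 m"
    unfolding qprod_def
  proof (intro prod.cong refl)
    fix j
    have "w ^ (Suc m + 1 + j) = w ^ Suc m * w ^ (0 + 1 + j)"
      unfolding power_add[symmetric] by (rule arg_cong[where f = "(^) w"]) simp
    then show "1 - w ^ (Suc m + 1 + j) = 1 - w ^ (0 + 1 + j)" unfolding w by simp
  qed
  then show ?thesis
    using qbinom_mult_qprod[of w "Suc m" m] qprod_0_neq_0[OF ord] by simp
qed

text \<open>Let n = 2m+1 and t = w^(1+...+m). Reflecting exponents i to n-i shows that t times the
  binomial is (-1)^m, and that the square of \<open>plusprod w m\<close> is t. Since t^2 =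
  w^(m(m+1)), w t^8 = w^(n^2) = 1, whence t^(-4) = w t^4.\<close>

lemma qbinom_half_pow4:
  fixes w :: complex
  assumes "w \<in> primroots (2 * m + 1)"
  shows "qbinom w m m ^ 4 = w * (plusprod w m ^ 2) ^ 4"
proof -
  have w: "w ^ (2 * m + 1) = 1" and ord: "\<And>i. 0 < i \<Longrightarrow> i \<le> m \<Longrightarrow> w ^ i \<noteq> 1"
    using assms by (auto simp: primroots_def)
  define t where "t = (\<Prod>j<m. w ^ Suc j)"
  \<comment> \<open>The exponents m+1 to 2m are listed backwards, so that the j-th one is 2m+1 minus
    \<open>Suc j\<close>.\<close>
  have refl_pow: "w ^ (m + 1 + (m - Suc j)) * w ^ Suc j = 1" if "j < m" for j
  proof -
    have "w ^ (m + 1 + (m - Suc j)) * w ^ Suc j = w ^ (2 * m + 1)"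
      unfolding power_add[symmetric] by (rule arg_cong[where f = "(^) w"]) (use that in simp)
    then show ?thesis unfolding w .
  qed
  have "qprod w m m * t = (\<Prod>j<m. 1 - w ^ (m + 1 + (m - Suc j))) * t"
    unfolding qprod_def by (subst prod.nat_diff_reindex) simp
  also have "\<dots> = (\<Prod>j<m. (-1) * (1 - w ^ (0 + 1 + j)))"
    unfolding t_def prod.distrib[symmetric]
    by (intro prod.cong refl) (use refl_pow in \<open>simp add: left_diff_distrib del: power_Suc\<close>)
  also have "\<dots> = (-1) ^ m * qprod w 0 m"
    unfolding qprod_def prod.distrib by simp
  finally have "(qbinom w m m * t) * qprod w 0 m = (-1) ^ m * qprod w 0 m"
    unfolding qbinom_mult_qprod[of w m m, symmetric] by (simp only: mult_ac)
  then have "qbinom w m m * t = (-1) ^ m" using qprod_0_neq_0[OF ord] by simp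
  then have "(qbinom w m m * t) ^ 4 = 1" by (simp flip: power_mult)
  then have W: "qbinom w m m ^ 4 * t ^ 4 = 1" by (simp only: power_mult_distrib)
  have "(\<Prod>j<m + k. 1 + w ^ Suc j) = (\<Prod>j<m. 1 + w ^ Suc j) * (\<Prod>j<k. 1 + w ^ (m + 1 + j))" for k
    by (induction k) (simp_all add: mult.assoc)
  then have "plusprod w (2 * m) = plusprod w m * (\<Prod>j<m. 1 + w ^ (m + 1 + j))"
    by (simp only: plusprod_def mult_2)
  \<comment> \<open>The full product up to 2m is 1, so t may be multiplied by it; its upper half
    absorbs t by reflection and becomes a second copy of \<open>plusprod w m\<close>.\<close>
  then have "t = plusprod w m * ((\<Prod>j<m. 1 + w ^ (m + 1 + j)) * t)"
    using plusprod_eq_1[OF assms] by (metis mult.assoc mult_1)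
  also have "(\<Prod>j<m. 1 + w ^ (m + 1 + j)) * t = (\<Prod>j<m. 1 + w ^ (m + 1 + (m - Suc j))) * t"
    by (subst prod.nat_diff_reindex) simp
  also have "\<dots> = plusprod w m"
    unfolding t_def prod.distrib[symmetric] plusprod_def
    by (intro prod.cong refl) (use refl_pow in \<open>simp add: distrib_right add.commute del: power_Suc\<close>)
  finally have V: "plusprod w m ^ 2 = t" by (simp only: power2_eq_square)
  have t2: "(\<Prod>j<k. w ^ Suc j) ^ 2 = w ^ (k * (k + 1))" for k
    by (induction k) (simp_all add: power_mult_distrib power2_eq_square power_add[symmetric] algebra_simps)
  have "w * t ^ 8 = w * (t ^ 2) ^ 4" by (simp flip: power_mult)
  also have "\<dots> = w ^ (1 + m * (m + 1) * 4)" 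
    unfolding t_def t2 power_mult[symmetric] power_add by simp
  also have "1 + m * (m + 1) * 4 = (2 * m + 1) * (2 * m + 1)" by (simp add: algebra_simps)
  also have "w ^ \<dots> = 1" unfolding power_mult[of w "2 * m + 1"] w by simp
  finally have "w * t ^ 4 * t ^ 4 = 1" by (simp add: mult.assoc flip: power_add)
  moreover have "t ^ 4 \<noteq> 0" using W by auto
  ultimately show ?thesis unfolding V using W by (metis mult_right_cancel)
qed

section \<open>The congruences\<close>

lemma to_fract_of_nat: "to_fract (of_nat k) = of_nat k"
  by (induction k) simp_all

lemma to_fract_numeral [simp]: "to_fract (numeral k) = numeral k"
  using to_fract_of_nat[of "numeral k"] by simp

lemma cpoly_numeral [simp]: "cpoly (numeral k) = numeral k"
proof -
  have "cpoly (of_nat j) = of_nat j" for j by (induction j) simp_all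
  from this[of "numeral k"] show ?thesis by simp
qed

section \<open>The modulus as a monic integer polynomial and its complex roots\<close>

lemma qint_sq_poly_eq_sum: "qint_sq_poly n = (\<Sum>j<n. [:0, 0, 1:] ^ j)"
proof -
  have "monom 1 (2 * j) = ([:0, 0, 1:] ^ j :: int poly)" for j
  proof -
    have "[:0, 0, 1:] = ([:0, 1:]\<^sup>2 :: int poly)" by (simp add: power2_eq_square)
    then show ?thesis by (simp only: monom_altdef power_mult smult_1_left)
  qed
  then show ?thesis by (simp add: qint_sq_poly_def)
qed

lemma qint_sq_poly_mult: "([:0, 0, 1:] - 1) * qint_sq_poly n = monom 1 (2 * n) - 1"
proof -
  have "monom 1 (2 * n) = ([:0, 0, 1:] ^ n :: int poly)"
    by (induction n) (simp_all add: monom_Suc)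
  then show ?thesis
    using one_diff_power_eq[of "[:0, 0, 1:] :: int poly" n]
    unfolding qint_sq_poly_eq_sum by (simp add: algebra_simps)
qed

lemma lead_coeff_qint_sq_poly:
  assumes "n > 0"
  shows "lead_coeff (qint_sq_poly n) = 1"
proof -
  have "degree (monom 1 (2 * n) - 1 :: int poly) = 2 * n"
    using assms by (subst diff_conv_add_uminus, subst degree_add_eq_left) (auto simp: degree_monom_eq)
  then have "lead_coeff (monom 1 (2 * n) - 1 :: int poly) = 1" using assms by simp
  moreover have "[:0, 0, 1:] - 1 = ([:-1, 0, 1:] :: int poly)" by (simp add: one_pCons)
  ultimately show ?thesis
    unfolding qint_sq_poly_mult[symmetric] lead_coeff_mult by simp
qed

lemma qint_eq_to_fract: "qint (qv ^ 2) (int n) = to_fract (qint_sq_poly n)"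
proof -
  have Y: "qv\<^sup>2 = to_fract [:0, 0, 1:]"
    by (simp add: qv_to_fract power2_eq_square flip: to_fract_mult)
  have "1 - qv\<^sup>2 \<noteq> 0" using qv_power_neq[of 2] by auto
  then show ?thesis
    unfolding qint_def power_int_of_nat one_diff_power_eq[of "qv\<^sup>2"] qint_sq_poly_eq_sum
    by (simp add: Y)
qed

lemma cpoly_cyclotomic_square:
  assumes "n > 0"
  shows "cpoly (pcompose (cyclotomic n) [:0, 0, 1:]) = (\<Prod>w\<in>primroots n. [:- w, 0, 1:])"
  by (simp add: cpoly_pcompose cpoly_cyclotomic[OF assms] pcompose_prod pcompose_pCons map_poly_pCons)

lemma lead_coeff_cyclotomic_square:
  assumes "n > 0"
  shows "lead_coeff (pcompose (cyclotomic n) [:0, 0, 1:]) = 1"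
proof -
  have "of_int (lead_coeff (pcompose (cyclotomic n) [:0, 0, 1:])) = (1::complex)"
    unfolding lead_coeff_cpoly[symmetric] cpoly_cyclotomic_square[OF assms]
    by (simp add: lead_coeff_prod)
  then show ?thesis by simp
qed

text \<open>Reduces divisibility by Phi_n(q^2) to evaluation: its roots are simple because 0 is not
  a primitive root, and exact division by a monic polynomial stays integral.\<close>

lemma cyclotomic_square_dvd:
  assumes "n > 0" "\<And>z. z\<^sup>2 \<in> primroots n \<Longrightarrow> poly (cpoly p) z = 0"
  shows "pcompose (cyclotomic n) [:0, 0, 1:] dvd p"
proof -
  have "0 \<notin> primroots n" using assms(1) by (auto simp: primroots_def power_0_left)
  then have "cpoly (pcompose (cyclotomic n) [:0, 0, 1:]) dvd cpoly p"
    unfolding cpoly_cyclotomic_square[OF assms(1)]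
    using assms finite_primroots by (intro prod_quadratic_dvd) auto
  then obtain c where "cpoly p = cpoly (pcompose (cyclotomic n) [:0, 0, 1:]) * c" by auto
  then obtain s where "p = pcompose (cyclotomic n) [:0, 0, 1:] * s"
    by (rule cpoly_dvd_monic[OF lead_coeff_cyclotomic_square[OF assms(1)]])
  then show ?thesis by (rule dvdI)
qed

text \<open>Treats both factors of the modulus at once. A root of [n] has z^2 different from 1,
  since a sum of n ones does not vanish.\<close>

lemma modulus_root:
  assumes "n > 1" "poly (cpoly (qint_sq_poly n ^ 4 * pcompose (cyclotomic n) [:0, 0, 1:])) z = 0"
  shows "(z\<^sup>2) ^ n = 1" "z\<^sup>2 \<noteq> 1"
proof -
  have qs: "poly (cpoly (qint_sq_poly n)) z = (\<Sum>j<n. (z\<^sup>2) ^ j)"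
    unfolding qint_sq_poly_eq_sum poly_cpoly_sum by (simp add: map_poly_pCons power2_eq_square)
  from assms(2) consider "poly (cpoly (qint_sq_poly n)) z = 0" | "z\<^sup>2 \<in> primroots n"
    using assms(1) finite_primroots[of n]
    by (auto simp: cpoly_cyclotomic_square poly_prod power2_eq_square)
  then have "(z\<^sup>2) ^ n = 1 \<and> z\<^sup>2 \<noteq> 1"
  proof cases
    case 1
    then have 0: "(\<Sum>j<n. (z\<^sup>2) ^ j) = 0" using qs by simp
    then have "(z\<^sup>2) ^ n = 1" using one_diff_power_eq[of "z\<^sup>2" n] by simp
    moreover have "z\<^sup>2 \<noteq> 1" using 0 assms(1) by auto
    ultimately show ?thesis by simp
  next
    case 2
    then have "(z\<^sup>2) ^ n = 1 \<and> (z\<^sup>2) ^ 1 \<noteq> 1" using assms(1) unfolding primroots_def by blast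
    then show ?thesis by simp
  qed
  then show "(z\<^sup>2) ^ n = 1" "z\<^sup>2 \<noteq> 1" by auto
qed

text \<open>Common to both upper limits: \<open>rprod\<close> = [n] W / V makes the difference of
  the two sides [n]^4 A / B. With [n]^4 factored out exactly, it remains that B is coprime to the
  modulus, by \<open>V\<close>, and that Phi_n(q^2) divides A, checked pointwise by
  \<open>val\<close>.\<close>

lemma sum_summand_cong:
  fixes W V :: "int poly"
  assumes n: "n > 1"
    and rprod: "rprod (qv\<^sup>2) m * to_fract V = to_fract (qint_sq_poly n) * to_fract W"
    and V: "\<And>z. (z\<^sup>2) ^ n = 1 \<Longrightarrow> z\<^sup>2 \<noteq> 1 \<Longrightarrow> poly (cpoly V) z \<noteq> 0"
    and val: "\<And>z. z\<^sup>2 \<in> primroots n \<Longrightarrow>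
      poly (cpoly W) z ^ 4 * (2 * z ^ 3 * (z ^ (4 * m))\<^sup>2
        + (2 * z\<^sup>2 - z ^ 4 - 2 * z ^ 3 - 2 * z - 1) * z ^ (4 * m) + 2 * z) * z
      = (2 * z\<^sup>2 + 2 - z) * (poly (cpoly V) z ^ 4 * (z ^ 4 * (1 - z\<^sup>2)\<^sup>2))"
  shows "ratfun_cong (\<Sum>k=0..m. summand k)
           ((2 * qv + 2 * qv powi (-1) - 1) * qint (qv ^ 2) (int n) ^ 4)
           (qint_sq_poly n ^ 4 * pcompose (cyclotomic n) [:0, 0, 1:])"
proof -
  define x where "x = ([:0, 1:] :: int poly)"
  define N where "N = 2 * x ^ 3 * (x ^ (4 * m))\<^sup>2
        + (2 * x\<^sup>2 - x ^ 4 - 2 * x ^ 3 - 2 * x - 1) * x ^ (4 * m) + 2 * x"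
  define E where "E = x ^ 4 * (1 - x\<^sup>2)\<^sup>2"
  \<comment> \<open>The extra factor x clears q^(-1): 2q + 2q^(-1) - 1 = (2q^2 + 2 - q) / q.\<close>
  define A where "A = W ^ 4 * N * x - (2 * x\<^sup>2 + 2 - x) * (V ^ 4 * E)"
  define B where "B = V ^ 4 * E * x"
  have px: "poly (cpoly x) z = z" for z by (simp add: x_def map_poly_pCons)
  have qv: "qv = to_fract x" by (simp add: x_def qv_to_fract)
  let ?P = "qint_sq_poly n ^ 4 * pcompose (cyclotomic n) [:0, 0, 1:]"
  have monic: "lead_coeff ?P = 1"
    using n by (simp add: lead_coeff_mult lead_coeff_power lead_coeff_qint_sq_poly lead_coeff_cyclotomic_square)
  have roots: "poly (cpoly B) z \<noteq> 0" if "poly (cpoly ?P) z = 0" for z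
  proof -
    have z: "(z\<^sup>2) ^ n = 1" "z\<^sup>2 \<noteq> 1" using modulus_root[OF n that] by auto
    then have "z \<noteq> 0" using n by (auto simp: power_0_left)
    then show ?thesis using V[OF z] z(2) by (simp add: B_def E_def px)
  qed
  have cop: "coprime B ?P"
    by (rule coprime_monic_if_no_common_root[OF monic roots])
  \<comment> \<open>The modulus has a root, namely a square root of a primitive n-th root, and B
    does not vanish there.\<close>
  have "B \<noteq> 0"
  proof -
    have "primroots n \<noteq> {}"
    proof -
      have "1 \<in> {k. 1 \<le> k \<and> k \<le> n \<and> coprime k n}" using n by auto
      then show ?thesis using bij_betw_primroots[of n] n unfolding bij_betw_def by blast
    qed
    then obtain w where "w \<in> primroots n" by auto
    then have "csqrt w ^ 2 \<in> primroots n" by simp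
    moreover from this have "poly (cpoly ?P) (csqrt w) = 0"
      using n finite_primroots[of n] by (auto simp: cpoly_cyclotomic_square poly_prod power2_eq_square)
    then have "poly (cpoly B) (csqrt w) \<noteq> 0" by (rule roots)
    then show "B \<noteq> 0" by auto
  qed
  have "pcompose (cyclotomic n) [:0, 0, 1:] dvd A"
    by (rule cyclotomic_square_dvd) (use n val in \<open>simp_all add: A_def N_def E_def px\<close>)
  then have dvd: "?P dvd qint_sq_poly n ^ 4 * A" by (rule mult_dvd_mono[OF dvd_refl])
  have nz: "to_fract V \<noteq> 0" "to_fract E \<noteq> 0" "to_fract x \<noteq> 0"
    using \<open>B \<noteq> 0\<close> by (auto simp: B_def)
  have S: "(\<Sum>k=0..m. summand k) = rprod (qv\<^sup>2) m ^ 4 * (to_fract N / to_fract E)"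
    unfolding sum_summand by (simp add: N_def E_def qv)
  have R: "rprod (qv\<^sup>2) m = to_fract (qint_sq_poly n) * to_fract W / to_fract V"
    using rprod nz by (simp add: field_simps)
  have "(\<Sum>k=0..m. summand k) - (2 * qv + 2 * qv powi (-1) - 1) * qint (qv ^ 2) (int n) ^ 4
     = Fract (qint_sq_poly n ^ 4 * A) B"
    unfolding Fract_conv_to_fract qint_eq_to_fract S R using nz
    by (simp add: A_def B_def qv power_int_minus field_simps power_divide power_mult_distrib power2_eq_square)
  with cop dvd \<open>B \<noteq> 0\<close> show ?thesis unfolding ratfun_cong_def by blast
qed

text \<open>If w^(j+1) were -1, raising it to the odd power n would give 1 = -1.\<close>

lemma plusprod_neq_0:
  fixes w :: complex
  assumes "odd n" "w ^ n = 1"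
  shows "plusprod w m \<noteq> 0"
proof -
  have "1 + w ^ Suc j \<noteq> 0" for j
  proof
    assume "1 + w ^ Suc j = 0"
    then have "w ^ Suc j = - 1" by (metis add_eq_0_iff)
    then have "(w ^ Suc j) ^ n = - 1" using assms(1) by (simp add: power_minus_odd del: power_Suc)
    moreover have "(w ^ Suc j) ^ n = (w ^ n) ^ Suc j" by (simp only: power_mult[symmetric] mult.commute)
    ultimately show False using assms(2) by simp
  qed
  then show ?thesis by (auto simp: plusprod_def)
qed

text \<open>Handles the denominators [2n-1] and [n+1]. These lengths are -1 and 1 modulo n, so w^k =
  1 would force w = 1.\<close>

lemma sum_powers_neq_0:
  fixes w :: complex
  assumes "w ^ n = 1" "w \<noteq> 1" "k + 1 = 2 * n \<or> k = n + 1"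
  shows "(\<Sum>i<k. w ^ i) \<noteq> 0"
proof
  assume "(\<Sum>i<k. w ^ i) = 0"
  then have k: "w ^ k = 1" using one_diff_power_eq[of w k] by simp
  from assms(3) show False
  proof
    assume "k + 1 = 2 * n"
    then have "w ^ k * w = (w ^ n)\<^sup>2" 
      unfolding power_mult[symmetric] power_Suc2[symmetric] by (simp add: mult.commute del: power_Suc)
    then show False using k assms by simp
  next
    assume "k = n + 1"
    then show False using k assms by simp
  qed
qed

theorem theorem1:
  fixes n :: nat
  assumes "n > 1" and "odd n"
  shows "ratfun_cong (\<Sum>k=0..(n + 1) div 2. summand k)
           ((2 * qv + 2 * qv powi (-1) - 1) * qint (qv ^ 2) (int n) ^ 4)
           (qint_sq_poly n ^ 4 * pcompose (cyclotomic n) [:0, 0, 1:])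
       \<and> ratfun_cong (\<Sum>k=0..n - 1. summand k)
           ((2 * qv + 2 * qv powi (-1) - 1) * qint (qv ^ 2) (int n) ^ 4)
           (qint_sq_poly n ^ 4 * pcompose (cyclotomic n) [:0, 0, 1:])"
proof
  obtain m where m: "n = 2 * m + 1" using assms(2) by (auto elim: oddE)
  define Y where "Y = ([:0, 0, 1:] :: int poly)"
  have pY: "poly (cpoly Y) z = z\<^sup>2" for z by (simp add: Y_def map_poly_pCons power2_eq_square)
  have qY: "qv\<^sup>2 = to_fract Y"
    by (simp add: Y_def qv_to_fract power2_eq_square flip: to_fract_mult)
  have Y1: "(qv\<^sup>2) ^ i \<noteq> 1" if "i > 0" for i
    using qv_power_neq[of "2 * i"] that by (simp add: power_mult)
  have sq: "to_fract (qint_sq_poly k) = (\<Sum>i<k. (qv\<^sup>2) ^ i)" for k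
    by (simp add: qint_sq_poly_eq_sum qY Y_def)
  show "ratfun_cong (\<Sum>k=0..(n + 1) div 2. summand k)
           ((2 * qv + 2 * qv powi (-1) - 1) * qint (qv ^ 2) (int n) ^ 4)
           (qint_sq_poly n ^ 4 * pcompose (cyclotomic n) [:0, 0, 1:])"
  proof (rule sum_summand_cong[where W = "qbinom Y m m" and V = "(\<Sum>i<n + 1. Y ^ i) * plusprod Y m ^ 2"])
    show "rprod (qv\<^sup>2) ((n + 1) div 2) * to_fract ((\<Sum>i<n + 1. Y ^ i) * plusprod Y m ^ 2)
        = to_fract (qint_sq_poly n) * to_fract (qbinom Y m m)"
      using rprod_half[of "qv\<^sup>2" m] Y1
      by (simp add: m sq to_fract_qbinom to_fract_plusprod qY del: sum.lessThan_Suc)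
  next
    fix z :: complex assume "(z\<^sup>2) ^ n = 1" "z\<^sup>2 \<noteq> 1"
    then show "poly (cpoly ((\<Sum>i<n + 1. Y ^ i) * plusprod Y m ^ 2)) z \<noteq> 0"
      using sum_powers_neq_0[of "z\<^sup>2" n "n + 1"] plusprod_neq_0[OF assms(2), of "z\<^sup>2" m]
      unfolding cpoly_mult cpoly_power poly_mult poly_power poly_cpoly_sum poly_cpoly_plusprod pY by simp
  next
    fix z :: complex assume z: "z\<^sup>2 \<in> primroots n"
    define w where "w = z\<^sup>2"
    have w: "w ^ n = 1" "w \<noteq> 1" using z assms(1) by (auto simp: primroots_def w_def dest: spec[of _ 1])
    \<comment> \<open>The denominator [n+1] takes the value 1 at w, because w^(n+1) = w.\<close>
    have "(1 - w) * (\<Sum>i<n + 1. w ^ i) = (1 - w) * 1"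
      unfolding one_diff_power_eq[symmetric] using w by simp
    then have s: "(\<Sum>i<n + 1. w ^ i) = 1" using w(2) by (simp only: mult_cancel_left) simp
    have b: "qbinom w m m ^ 4 = w * (plusprod w m ^ 2) ^ 4"
      by (rule qbinom_half_pow4) (use z m in \<open>simp add: w_def\<close>)
    have "z ^ (4 * ((n + 1) div 2)) = w ^ (n + 1)"
      unfolding w_def power_mult[symmetric] by (rule arg_cong[where f = "(^) z"]) (simp add: m)
    then have X: "z ^ (4 * ((n + 1) div 2)) = z\<^sup>2" using w by (simp add: w_def)
    \<comment> \<open>Here W^4 = w V^4 and X = z^2, so up to the common factor V^4 this is a
      polynomial identity in z.\<close>
    show "poly (cpoly (qbinom Y m m)) z ^ 4 * (2 * z ^ 3 * (z ^ (4 * ((n + 1) div 2)))\<^sup>2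
        + (2 * z\<^sup>2 - z ^ 4 - 2 * z ^ 3 - 2 * z - 1) * z ^ (4 * ((n + 1) div 2)) + 2 * z) * z
      = (2 * z\<^sup>2 + 2 - z) * (poly (cpoly ((\<Sum>i<n + 1. Y ^ i) * plusprod Y m ^ 2)) z ^ 4 * (z ^ 4 * (1 - z\<^sup>2)\<^sup>2))"
      unfolding cpoly_mult cpoly_power poly_mult poly_power poly_cpoly_sum poly_cpoly_plusprod
        poly_cpoly_qbinom pY w_def[symmetric] s b X[folded w_def]
      unfolding w_def by algebra
  qed fact
  have n1: "n = Suc (n - 1)" using assms(1) by simp
  show "ratfun_cong (\<Sum>k=0..n - 1. summand k)
           ((2 * qv + 2 * qv powi (-1) - 1) * qint (qv ^ 2) (int n) ^ 4)
           (qint_sq_poly n ^ 4 * pcompose (cyclotomic n) [:0, 0, 1:])"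
  proof (rule sum_summand_cong[where W = "qbinom Y n (n - 1)"
        and V = "(\<Sum>i<2 * (n - 1) + 1. Y ^ i) * plusprod Y (n - 1) ^ 2"])
    show "rprod (qv\<^sup>2) (n - 1) * to_fract ((\<Sum>i<2 * (n - 1) + 1. Y ^ i) * plusprod Y (n - 1) ^ 2)
        = to_fract (qint_sq_poly n) * to_fract (qbinom Y n (n - 1))"
      using rprod_full[of "qv\<^sup>2" "n - 1"] Y1 n1
      by (simp add: sq to_fract_qbinom to_fract_plusprod qY del: sum.lessThan_Suc)
  next
    fix z :: complex assume "(z\<^sup>2) ^ n = 1" "z\<^sup>2 \<noteq> 1"
    then show "poly (cpoly ((\<Sum>i<2 * (n - 1) + 1. Y ^ i) * plusprod Y (n - 1) ^ 2)) z \<noteq> 0"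
      using sum_powers_neq_0[of "z\<^sup>2" n "2 * (n - 1) + 1", OF _ _ disjI1] plusprod_neq_0[OF assms(2), of "z\<^sup>2" "n - 1"] assms(1)
      unfolding cpoly_mult cpoly_power poly_mult poly_power poly_cpoly_sum poly_cpoly_plusprod pY
      by (simp del: sum.lessThan_Suc)
  next
    fix z :: complex assume z: "z\<^sup>2 \<in> primroots n"
    define w where "w = z\<^sup>2"
    have w: "w ^ n = 1" "w \<noteq> 1" using z assms(1) by (auto simp: primroots_def w_def dest: spec[of _ 1])
    have w0: "w \<noteq> 0" using w(1) assms(1) by (auto simp: power_0_left)
    \<comment> \<open>The value of [2n-1] at w is -1/w. Keeping it as \<open>s\<close> with s w = -1
      leaves the final identity polynomial.\<close>
    define s where "s = (\<Sum>i<2 * (n - 1) + 1. w ^ i)"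
    have "w ^ (2 * (n - 1) + 1) * w = (w ^ n)\<^sup>2"
      unfolding power_mult[symmetric] power_Suc2[symmetric]
      by (rule arg_cong[where f = "(^) w"]) (use assms(1) in simp)
    then have *: "w ^ (2 * (n - 1) + 1) * w = 1" using w by simp
    have "(1 - w) * (s * w) = (1 - w ^ (2 * (n - 1) + 1)) * w"
      unfolding s_def one_diff_power_eq by (simp only: mult.assoc)
    also have "\<dots> = (1 - w) * (- 1)" using * by (simp add: left_diff_distrib)
    finally have s: "s * w = - 1" using w(2) by (simp only: mult_cancel_left) simp
    have b: "qbinom w n (n - 1) = 1"
      using qbinom_full_eq_1[of w "n - 1"] n1 z by (simp add: w_def)
    have p: "plusprod w (n - 1) = 1"
      using plusprod_eq_1[of w m] z m by (simp add: w_def)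
    \<comment> \<open>Here X = w^(2n-2) = w^(-2), which is s^2.\<close>
    have "z ^ (4 * (n - 1)) * w\<^sup>2 = (w ^ n)\<^sup>2"
      unfolding w_def power_mult[symmetric] power_add[symmetric]
      by (rule arg_cong[where f = "(^) z"]) (use assms(1) in simp)
    then have "z ^ (4 * (n - 1)) * w\<^sup>2 = (s * w)\<^sup>2" using w s by simp
    then have X: "z ^ (4 * (n - 1)) = s\<^sup>2" using w0 by (simp add: power_mult_distrib)
    have sz: "s * z\<^sup>2 = - 1" using s by (simp add: w_def)
    show "poly (cpoly (qbinom Y n (n - 1))) z ^ 4 * (2 * z ^ 3 * (z ^ (4 * (n - 1)))\<^sup>2
        + (2 * z\<^sup>2 - z ^ 4 - 2 * z ^ 3 - 2 * z - 1) * z ^ (4 * (n - 1)) + 2 * z) * z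
      = (2 * z\<^sup>2 + 2 - z) * (poly (cpoly ((\<Sum>i<2 * (n - 1) + 1. Y ^ i) * plusprod Y (n - 1) ^ 2)) z ^ 4 * (z ^ 4 * (1 - z\<^sup>2)\<^sup>2))"
      unfolding cpoly_mult cpoly_power poly_mult poly_power poly_cpoly_sum poly_cpoly_plusprod
        poly_cpoly_qbinom pY w_def[symmetric] s_def[symmetric] b p X
      unfolding w_def power_one mult_1_left mult_1_right using sz by algebra
  qed fact
qed

end
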